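(* Assume that, for every 2D SLP $G = (V_{l}, V_{h}, V_{v}, \Sigma, R, S)$, where $\Sigma = \{0,1\}$, representing a 2D string $T \in \{0,1\}^{r \times c}$, there exists a data structure of size $\mathcal{O}(|G| \cdot \log^{\mathcal{O}(1)} n)$ that answers one of the following query types: (a) line sum queries, (b) sum queries, on $T$ in $\mathcal{O}(\log^{\mathcal{O}(1)} n)$ time, where $n = \max(r, c)$. Then, for every 1D SLP $\hat{G} = (\hat{V}, \hat{\Sigma}, \hat{R}, \hat{S})$ representing $\hat{T} \in \hat{\Sigma}^{\hat{n}}$, where $\hat{\Sigma} = [0 \mathinner{.\,.} \hat{\sigma})$ and $\hat{\sigma} = \hat{n}^{\mathcal{O}(1)}$, there exists a data structure of size $\mathcal{O}(|\hat{G}| \cdot \log^{\mathcal{O}(1)} \hat{n})$ that answers rank queries on $\hat{T}$ in $\mathcal{O}(\log^{\mathcal{O}(1)} \hat{n})$ time.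
   Context: A 1D SLP is a straight-line grammar in which every nonterminal $N$ has a unique rule $N \to AB$ with $A,B$ nonterminals or $N \to a$ with $a$ a terminal, and nonterminals can be ordered so each rule refers only to later nonterminals; it represents the unique string derived from the start symbol. A 2D SLP $G=(V_l,V_h,V_v,\Sigma,R,S)$ has literal nonterminals ($N \to a$, expanding to the $1\times 1$ matrix $a$), horizontal nonterminals $N \to AB$ whose expansion is the expansion of $A$ placed on top of the expansion of $B$ (they must have equal numbers of columns), and vertical nonterminals $N \to AB$ whose expansion is the expansion of $A$ placed to the left of the expansion of $B$ (equal numbers of rows), again acyclic; it represents the expansion of $S$. The size of a (1D or 2D) grammar is $|G| = \sum_{N} \max(|\mathrm{rhs}(N)|,1)$. For $T \in \mathbb{Z}_{\ge 0}^{r \times c}$: a sum query, given $b_r,e_r \in [0 \mathinner{.\,.} r]$ and $b_c,e_c \in [0 \mathinner{.\,.} c]$, returns $\sum_{(i,j) \in (b_r \mathinner{.\,.} e_r] \times (b_c \mathinner{.\,.} e_c]} T[i,j]$. A line sum query, given $\ell \ge 0$, $e_r \in [1 \mathinner{.\,.} r]$ and $e_c \in [0 \mathinner{.\,.} c]$ with $e_c \ge \ell$, returns the sum query on $(e_r-1 \mathinner{.\,.} e_r] \times (e_c-\ell \mathinner{.\,.} e_c]$, i.e., the sum of $T[e_r, j]$ over $j \in (e_c-\ell \mathinner{.\,.} e_c]$. For a string $T \in \Sigma^{n}$, a rank query, given $j \in [0 \mathinner{.\,.} n]$ and $c \in \Sigma$, returns $|\{i \in (0 \mathinner{.\,.}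 j] : T[i] = c\}|$. *)

theory Defs
  imports Complex_Main "Jordan_Normal_Form.Matrix"
begin

section \<open>Straight-line grammars\<close>

text \<open>Nonterminals are natural numbers.  Rules are given by a function, since every nonterminal
  has exactly one rule; its values outside the set of nonterminals are irrelevant.\<close>

datatype 'a rhs = Lit 'a | Cat nat nat

fun rhs_length :: "'a rhs \<Rightarrow> nat" where
  "rhs_length (Lit a) = 1"
| "rhs_length (Cat A B) = 2"

definition acyclic_rules :: "nat set \<Rightarrow> (nat \<Rightarrow> 'a rhs) \<Rightarrow> bool" where
  "acyclic_rules V R \<longleftrightarrow>
     (\<exists>pos :: nat \<Rightarrow> nat. inj_on pos V \<and>
        (\<forall>N\<in>V. \<forall>A B. R N = Cat A B \<longrightarrow> pos N < pos A \<and> pos N < pos B))"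

definition rules_size :: "nat set \<Rightarrow> (nat \<Rightarrow> 'a rhs) \<Rightarrow> nat" where
  "rules_size V R = (\<Sum>N\<in>V. max (rhs_length (R N)) 1)"


subsection \<open>1D SLPs\<close>

record 'a slp1 =
  nonterms1 :: "nat set"
  alphabet1 :: "'a set"
  rule1 :: "nat \<Rightarrow> 'a rhs"
  start1 :: nat

definition valid_slp1 :: "'a slp1 \<Rightarrow> bool" where
  "valid_slp1 G \<longleftrightarrow>
     finite (nonterms1 G) \<and> start1 G \<in> nonterms1 G \<and>
     (\<forall>N\<in>nonterms1 G.
        (\<exists>a\<in>alphabet1 G. rule1 G N = Lit a) \<or>
        (\<exists>A\<in>nonterms1 G. \<exists>B\<in>nonterms1 G. rule1 G N = Cat A B)) \<and>
     acyclic_rules (nonterms1 G) (rule1 G)"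

inductive expands1 :: "'a slp1 \<Rightarrow> nat \<Rightarrow> 'a list \<Rightarrow> bool" for G where
  lit: "N \<in> nonterms1 G \<Longrightarrow> rule1 G N = Lit a \<Longrightarrow> expands1 G N [a]"
| cat: "N \<in> nonterms1 G \<Longrightarrow> rule1 G N = Cat A B \<Longrightarrow>
          expands1 G A u \<Longrightarrow> expands1 G B v \<Longrightarrow> expands1 G N (u @ v)"

definition represents1 :: "'a slp1 \<Rightarrow> 'a list \<Rightarrow> bool" where
  "represents1 G T \<longleftrightarrow> expands1 G (start1 G) T"

definition size_slp1 :: "'a slp1 \<Rightarrow> nat" where
  "size_slp1 G = rules_size (nonterms1 G) (rule1 G)"


subsection \<open>2D SLPs\<close>

record 'a slp2 =
  literals :: "nat set"
  horizontals :: "nat set"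
  verticals :: "nat set"
  alphabet2 :: "'a set"
  rule2 :: "nat \<Rightarrow> 'a rhs"
  start2 :: nat

definition nonterms2 :: "'a slp2 \<Rightarrow> nat set" where
  "nonterms2 G = literals G \<union> horizontals G \<union> verticals G"

text \<open>\<^term>\<open>A @\<^sub>r B\<close> places the matrix \<open>A\<close> on top of \<open>B\<close>; the following is its analogue that
  places \<open>A\<close> to the left of \<open>B\<close>.\<close>

definition append_cols :: "'a :: zero mat \<Rightarrow> 'a mat \<Rightarrow> 'a mat" where
  "append_cols A B = four_block_mat A B (0\<^sub>m 0 (dim_col A)) (0\<^sub>m 0 (dim_col B))"

inductive expands2 :: "('a :: zero) slp2 \<Rightarrow> nat \<Rightarrow> 'a mat \<Rightarrow> bool" for G where
  lit: "N \<in> literals G \<Longrightarrow> rule2 G N = Lit a \<Longrightarrow> expands2 G N (mat 1 1 (\<lambda>_. a))"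
| hor: "N \<in> horizontals G \<Longrightarrow> rule2 G N = Cat A B \<Longrightarrow>
          expands2 G A X \<Longrightarrow> expands2 G B Y \<Longrightarrow> expands2 G N (X @\<^sub>r Y)"
| ver: "N \<in> verticals G \<Longrightarrow> rule2 G N = Cat A B \<Longrightarrow>
          expands2 G A X \<Longrightarrow> expands2 G B Y \<Longrightarrow> expands2 G N (append_cols X Y)"

definition valid_slp2 :: "('a :: zero) slp2 \<Rightarrow> bool" where
  "valid_slp2 G \<longleftrightarrow>
     finite (nonterms2 G) \<and> start2 G \<in> nonterms2 G \<and>
     literals G \<inter> horizontals G = {} \<and> literals G \<inter> verticals G = {} \<and>
     horizontals G \<inter> verticals G = {} \<and>
     (\<forall>N\<in>literals G. \<exists>a\<in>alphabet2 G. rule2 G N = Lit a) \<and>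
     (\<forall>N\<in>horizontals G \<union> verticals G.
        \<exists>A\<in>nonterms2 G. \<exists>B\<in>nonterms2 G. rule2 G N = Cat A B) \<and>
     acyclic_rules (nonterms2 G) (rule2 G) \<and>
     (\<forall>N\<in>horizontals G. \<forall>A B X Y. rule2 G N = Cat A B \<longrightarrow>
        expands2 G A X \<longrightarrow> expands2 G B Y \<longrightarrow> dim_col X = dim_col Y) \<and>
     (\<forall>N\<in>verticals G. \<forall>A B X Y. rule2 G N = Cat A B \<longrightarrow>
        expands2 G A X \<longrightarrow> expands2 G B Y \<longrightarrow> dim_row X = dim_row Y)"

definition represents2 :: "('a :: zero) slp2 \<Rightarrow> 'a mat \<Rightarrow> bool" where
  "represents2 G T \<longleftrightarrow> expands2 G (start2 G) T"

definition size_slp2 :: "'a slp2 \<Rightarrow> nat" where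
  "size_slp2 G = rules_size (nonterms2 G) (rule2 G)"


section \<open>Queries\<close>

text \<open>Positions in queries are counted from 1, whereas matrices and lists are indexed from 0.\<close>

definition sum_query :: "nat mat \<Rightarrow> nat \<Rightarrow> nat \<Rightarrow> nat \<Rightarrow> nat \<Rightarrow> nat" where
  "sum_query T br er bc ec = (\<Sum>(i, j) \<in> {br<..er} \<times> {bc<..ec}. T $$ (i - 1, j - 1))"

definition line_sum_query :: "nat mat \<Rightarrow> nat \<Rightarrow> nat \<Rightarrow> nat \<Rightarrow> nat" where
  "line_sum_query T l er ec = sum_query T (er - 1) er (ec - l) ec"

definition rank_query :: "'a list \<Rightarrow> nat \<Rightarrow> 'a \<Rightarrow> nat" where
  "rank_query T j c = card {i \<in> {0<..j}. T ! (i - 1) = c}"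

text \<open>A query problem is a set of pairs consisting of an admissible argument list and the
  expected answer.\<close>

definition sum_queries :: "nat mat \<Rightarrow> (nat list \<times> nat) set" where
  "sum_queries T =
     {([br, er, bc, ec], sum_query T br er bc ec) | br er bc ec.
        br \<le> dim_row T \<and> er \<le> dim_row T \<and> bc \<le> dim_col T \<and> ec \<le> dim_col T}"

definition line_sum_queries :: "nat mat \<Rightarrow> (nat list \<times> nat) set" where
  "line_sum_queries T =
     {([l, er, ec], line_sum_query T l er ec) | l er ec.
        1 \<le> er \<and> er \<le> dim_row T \<and> ec \<le> dim_col T \<and> l \<le> ec}"

definition rank_queries :: "nat set \<Rightarrow> nat list \<Rightarrow> (nat list \<times> nat) set" where
  "rank_queries \<Sigma> T = {([j, c], rank_query T j c) | j c. j \<le> length T \<and> c \<in> \<Sigma>}"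


section \<open>Word RAM\<close>

text \<open>A program is a list of instructions over registers (which are named statically by the
  program) and a random access memory addressed through registers.  All words have \<open>w\<close> bits.
  An instruction whose result does not fit into a word makes the run fail.  Up to a constant factor
  in \<open>w\<close> and in the running time this agrees with arithmetic modulo \<open>2 ^ w\<close>.\<close>

datatype binop = Add | Sub | Mul | Div | Mod | And | Or | Xor | Shl | Shr

fun eval_binop :: "binop \<Rightarrow> nat \<Rightarrow> nat \<Rightarrow> nat" where
  "eval_binop Add x y = x + y"
| "eval_binop Sub x y = x - y"
| "eval_binop Mul x y = x * y"
| "eval_binop Div x y = x div y"
| "eval_binop Mod x y = x mod y"
| "eval_binop And x y = Bit_Operations.and x y"
| "eval_binop Or x y = Bit_Operations.or x y"
| "eval_binop Xor x y = Bit_Operations.xor x y"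
| "eval_binop Shl x y = push_bit y x"
| "eval_binop Shr x y = drop_bit y x"

datatype instr =
    Const nat nat           \<comment> \<open>target register, value\<close>
  | Op binop nat nat nat    \<comment> \<open>target register, operand registers\<close>
  | Load nat nat            \<comment> \<open>target register, address register\<close>
  | Store nat nat           \<comment> \<open>address register, source register\<close>
  | Jump nat
  | JumpLess nat nat nat    \<comment> \<open>compared registers, target\<close>
  | Halt

record ram_state =
  pc :: nat
  reg :: "nat \<Rightarrow> nat"
  mem :: "nat \<Rightarrow> nat"

definition set_reg :: "nat \<Rightarrow> nat \<Rightarrow> nat \<Rightarrow> ram_state \<Rightarrow> ram_state option" where
  "set_reg w r v s =
     (if v < 2 ^ w then Some (s\<lparr>pc := pc s + 1, reg := (reg s)(r := v)\<rparr>) else None)"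

fun exec_instr :: "nat \<Rightarrow> instr \<Rightarrow> ram_state \<Rightarrow> ram_state option" where
  "exec_instr w (Const r v) s = set_reg w r v s"
| "exec_instr w (Op f r a b) s = set_reg w r (eval_binop f (reg s a) (reg s b)) s"
| "exec_instr w (Load r a) s = set_reg w r (mem s (reg s a)) s"
| "exec_instr w (Store a r) s = Some (s\<lparr>pc := pc s + 1, mem := (mem s)(reg s a := reg s r)\<rparr>)"
| "exec_instr w (Jump l) s = Some (s\<lparr>pc := l\<rparr>)"
| "exec_instr w (JumpLess a b l) s =
     Some (s\<lparr>pc := (if reg s a < reg s b then l else pc s + 1)\<rparr>)"
| "exec_instr w Halt s = None"

text \<open>\<open>ram_returns w P s t v\<close>: from state \<open>s\<close>, program \<open>P\<close> halts after executing exactly \<open>t\<close>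
  instructions, with \<open>v\<close> in register 0.\<close>

inductive ram_returns :: "nat \<Rightarrow> instr list \<Rightarrow> ram_state \<Rightarrow> nat \<Rightarrow> nat \<Rightarrow> bool" for w P where
  halt: "pc s < length P \<Longrightarrow> P ! pc s = Halt \<Longrightarrow> ram_returns w P s 1 (reg s 0)"
| step: "pc s < length P \<Longrightarrow> exec_instr w (P ! pc s) s = Some s' \<Longrightarrow>
           ram_returns w P s' t v \<Longrightarrow> ram_returns w P s (Suc t) v"

definition init_state :: "nat list \<Rightarrow> nat list \<Rightarrow> ram_state" where
  "init_state D args =
     \<lparr>pc = 0,
      reg = (\<lambda>i. if i < length args then args ! i else 0),
      mem = (\<lambda>i. if i < length D then D ! i else 0)\<rparr>"


section \<open>Data structures\<close>

text \<open>\<open>D\<close> is the data structure, a sequence of memory words; \<open>P\<close> is the query algorithm.\<close>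

definition answers ::
  "nat \<Rightarrow> instr list \<Rightarrow> nat list \<Rightarrow> (nat list \<times> nat) set \<Rightarrow> real \<Rightarrow> bool" where
  "answers w P D Q time \<longleftrightarrow>
     (\<forall>x\<in>set D. x < 2 ^ w) \<and>
     (\<forall>(args, ans)\<in>Q. (\<forall>x\<in>set args. x < 2 ^ w) \<and>
        (\<exists>t. real t \<le> time \<and> ram_returns w P (init_state D args) t ans))"

text \<open>The logarithm in asymptotic bounds; it differs from \<open>log 2 n\<close> only for \<open>n < 2\<close>, so that the
  bounds do not degenerate to 0 at \<open>n = 1\<close>.\<close>

definition lg :: "nat \<Rightarrow> real" where
  "lg n = max 1 (log 2 (real n))"

text \<open>Every instance \<open>x \<in> I\<close>, of grammar size \<open>g x\<close> and length parameter \<open>n x\<close>, admits a data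
  structure of \<open>O(g x * log^O(1) (n x))\<close> words of \<open>O(log (n x))\<close> bits each that answers the queries
  \<open>Q x\<close> in \<open>O(log^O(1) (n x))\<close> time.  The query algorithm \<open>P\<close> and the hidden constants do not depend
  on the instance.\<close>

definition has_polylog_structures ::
  "'i set \<Rightarrow> ('i \<Rightarrow> nat) \<Rightarrow> ('i \<Rightarrow> nat) \<Rightarrow> ('i \<Rightarrow> (nat list \<times> nat) set) \<Rightarrow> bool" where
  "has_polylog_structures I g n Q \<longleftrightarrow>
     (\<exists>P :: instr list. \<exists>C k :: nat. \<forall>x\<in>I. \<exists>D :: nat list.
        real (length D) \<le> real C * real (g x) * lg (n x) ^ k \<and>
        answers (C * nat \<lceil>lg (n x)\<rceil>) P D (Q x) (real C * lg (n x) ^ k))"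

end

theory Submission
  imports Defs "HOL-Library.Nat_Bijection"
begin

text \<open>Let \<open>m\<close> be so large that \<open>2 ^ m\<close> bounds the alphabet size, with \<open>m = O(log n)\<close>.  The 0/1 matrix
  with \<open>2 ^ m\<close> rows whose row \<open>c\<close> marks the occurrences of the letter \<open>c\<close> in the string turns a rank
  query into a sum over a prefix of a single row.  It is represented by a 2D SLP that mirrors the
  1D SLP with vertical rules; only the literals have to be replaced by unit column vectors of
  height \<open>2 ^ m\<close>, and each of these is built in \<open>m\<close> steps by stacking it with zero columns whose
  heights are powers of two, following the binary digits of the letter.\<close>

section \<open>Straight-line code in front of a program\<close>

fun straight :: "instr \<Rightarrow> bool" where
  "straight (Jump l) = False"
| "straight (JumpLess a b l) = False"
| "straight Halt = False"
| "straight i = True"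

fun exec_straight :: "nat \<Rightarrow> instr list \<Rightarrow> ram_state \<Rightarrow> ram_state option" where
  "exec_straight w [] s = Some s"
| "exec_straight w (i # is) s = Option.bind (exec_instr w i s) (exec_straight w is)"

text \<open>Jump targets are absolute addresses, so a program moved behind \<open>m\<close> other
  instructions needs all of them shifted.\<close>

fun relocate :: "nat \<Rightarrow> instr \<Rightarrow> instr" where
  "relocate m (Jump l) = Jump (m + l)"
| "relocate m (JumpLess a b l) = JumpLess a b (m + l)"
| "relocate m i = i"

text \<open>The word size enters only through the overflow test in \<open>set_reg\<close>, which a
  larger word can only relax.\<close>

lemma exec_instr_mono:
  assumes "exec_instr w i s = Some s'" "w \<le> w'"
  shows "exec_instr w' i s = Some s'"
proof -
  have "v < 2 ^ w \<Longrightarrow> v < 2 ^ w'" for v :: nat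
    using assms(2) by (meson less_le_trans one_le_numeral power_increasing)
  with assms(1) show ?thesis
    by (cases i) (auto simp: set_reg_def split: if_splits)
qed

lemma ram_returns_mono:
  assumes "ram_returns w P s t v" "w \<le> w'"
  shows "ram_returns w' P s t v"
  using assms(1)
proof induction
  case (halt s)
  then show ?case by (rule ram_returns.halt)
next
  case (step s s' t v)
  show ?case
    using step.hyps(1) exec_instr_mono[OF step.hyps(2) assms(2)] step.IH by (rule ram_returns.step)
qed

lemma exec_instr_relocate:
  assumes "exec_instr w i s = Some s'"
  shows "exec_instr w (relocate m i) (s\<lparr>pc := m + pc s\<rparr>) = Some (s'\<lparr>pc := m + pc s'\<rparr>)"
  using assms by (cases i) (auto simp: set_reg_def split: if_splits)

text \<open>The two runs stay in lockstep: registers and memory agree throughout and the program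
  counters differ by \<open>length pre\<close>. Hence the running time is unchanged.\<close>

lemma ram_returns_relocate:
  assumes "ram_returns w P s t v"
  shows "ram_returns w (pre @ map (relocate (length pre)) P) (s\<lparr>pc := length pre + pc s\<rparr>) t v"
  using assms
proof induction
  case (halt s)
  then show ?case
    using ram_returns.halt[of "s\<lparr>pc := length pre + pc s\<rparr>" "pre @ map (relocate (length pre)) P" w]
    by simp
next
  case (step s s' t v)
  show ?case
    by (rule ram_returns.step[OF _ _ step.IH])
      (use step.hyps in \<open>simp_all add: exec_instr_relocate\<close>)
qed

lemma exec_instr_straight_pc:
  assumes "exec_instr w i s = Some s'" "straight i"
  shows "pc s' = Suc (pc s)"
  using assms by (cases i) (auto simp: set_reg_def split: if_splits)

text \<open>The block sits between arbitrary \<open>xs\<close> and \<open>ys\<close> so that the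
  induction can move each executed instruction from the front of \<open>code\<close> to the end of
  \<open>xs\<close> while the whole program stays fixed.\<close>

lemma ram_returns_straight:
  assumes "\<forall>i\<in>set code. straight i" "exec_straight w code s = Some s'" "pc s = length xs"
    and "ram_returns w (xs @ code @ ys) s' t v"
  shows "ram_returns w (xs @ code @ ys) s (length code + t) v"
  using assms
proof (induction code arbitrary: xs s)
  case Nil
  then show ?case by simp
next
  case (Cons i code)
  from Cons.prems(2) obtain s1 where s1: "exec_instr w i s = Some s1" "exec_straight w code s1 = Some s'"
    by (auto simp: bind_eq_Some_conv)
  have "ram_returns w ((xs @ [i]) @ code @ ys) s1 (length code + t) v"
  proof (rule Cons.IH)
    show "pc s1 = length (xs @ [i])"
      using exec_instr_straight_pc[OF s1(1)] Cons.prems by simp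
  qed (use Cons.prems s1 in simp_all)
  with s1(1) Cons.prems(3) show ?case
    by (auto intro: ram_returns.step)
qed

section \<open>Reductions between query problems\<close>

lemma lg_ge_1: "1 \<le> lg n"
  by (simp add: lg_def)

text \<open>The structure of \<open>f y\<close> is kept unchanged and \<open>pre\<close> rewrites
  the arguments in place before the old program runs. In \<open>query\<close>, the word size is
  universally quantified because it becomes known only with the constants of the given structures;
  the bound on \<open>args\<close> has to follow from the one on \<open>args'\<close>.\<close>

lemma has_polylog_structures_reduction:
  fixes E :: nat
  assumes structures: "has_polylog_structures I g n Q"
    and straight: "\<forall>i\<in>set pre. straight i"
    and instance_I: "\<And>y. y \<in> J \<Longrightarrow> f y \<in> I"
    and instance_size: "\<And>y. y \<in> J \<Longrightarrow> real (g (f y)) \<le> real E * real (g' y) * lg (n' y)"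
    and instance_lg: "\<And>y. y \<in> J \<Longrightarrow> lg (n (f y)) \<le> real E * lg (n' y)"
    and query: "\<And>y args ans. y \<in> J \<Longrightarrow> (args, ans) \<in> Q' y \<Longrightarrow>
      \<exists>args'. (args', ans) \<in> Q (f y) \<and>
        (\<forall>w D. (\<forall>v\<in>set args'. v < 2 ^ w) \<longrightarrow> (\<forall>v\<in>set args. v < 2 ^ w) \<and>
           exec_straight w pre (init_state D args) =
             Some ((init_state D args')\<lparr>pc := length pre\<rparr>))"
  shows "has_polylog_structures J g' n' Q'"
proof -
  obtain P C k where P: "\<And>x. x \<in> I \<Longrightarrow> \<exists>D. real (length D) \<le> real C * real (g x) * lg (n x) ^ k \<and>
      answers (C * nat \<lceil>lg (n x)\<rceil>) P D (Q x) (real C * lg (n x) ^ k)"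
    using structures unfolding has_polylog_structures_def by blast
  \<comment> \<open>\<open>Suc\<close> makes the factor at least 1 even if
    \<open>E = 0\<close>.\<close>
  define F where "F = Suc E"
  \<comment> \<open>\<open>length pre\<close> pays for the added instructions, 2 for rounding the
    logarithm up, \<open>F ^ k\<close> for changing the logarithm under the power, and the last
    \<open>F\<close> for the grammar size. The exponent grows to \<open>Suc k\<close> since the size
    bound costs one more logarithm.\<close>
  define C' where "C' = (C + length pre) * 2 * F ^ Suc k"
  define P' where "P' = pre @ map (relocate (length pre)) P"
  have "\<exists>D. real (length D) \<le> real C' * real (g' y) * lg (n' y) ^ Suc k \<and>
      answers (C' * nat \<lceil>lg (n' y)\<rceil>) P' D (Q' y) (real C' * lg (n' y) ^ Suc k)" if y: "y \<in> J" for y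
  proof -
    obtain D where D: "real (length D) \<le> real C * real (g (f y)) * lg (n (f y)) ^ k"
      and ans: "answers (C * nat \<lceil>lg (n (f y))\<rceil>) P D (Q (f y)) (real C * lg (n (f y)) ^ k)"
      using P[OF instance_I[OF y]] by blast
    define L where "L = lg (n' y)"
    define w where "w = C * nat \<lceil>lg (n (f y))\<rceil>"
    define w' where "w' = C' * nat \<lceil>L\<rceil>"
    have L: "1 \<le> L" unfolding L_def by (rule lg_ge_1)
    have F: "1 \<le> real F" by (simp add: F_def)
    have FL: "lg (n (f y)) \<le> real F * L"
      using instance_lg[OF y] L unfolding L_def F_def
      by (smt (verit) mult_right_mono of_nat_mono le_SucI order_refl)
    have gF: "real (g (f y)) \<le> real F * real (g' y) * L"
    proof -
      have "real E * real (g' y) * L \<le> real F * real (g' y) * L"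
        using L by (intro mult_right_mono) (auto simp: F_def)
      with instance_size[OF y] show ?thesis unfolding L_def by linarith
    qed
    have pow: "lg (n (f y)) ^ k \<le> real F ^ k * L ^ k"
      using power_mono[OF FL, of k] lg_ge_1[of "n (f y)"] by (simp add: power_mult_distrib)
    have "real C * real (g (f y)) * lg (n (f y)) ^ k
        \<le> real C * (real F * real (g' y) * L) * (real F ^ k * L ^ k)"
      using gF pow L lg_ge_1[of "n (f y)"] by (intro mult_mono) auto
    also have "\<dots> = (real C * real F ^ Suc k) * (real (g' y) * L ^ Suc k)"
      by (simp add: mult_ac)
    also have "\<dots> \<le> real C' * (real (g' y) * L ^ Suc k)"
      using F L by (intro mult_right_mono) (auto simp: C'_def)
    finally have size: "real (length D) \<le> real C' * real (g' y) * L ^ Suc k"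
      using D by (simp add: mult_ac)
    have time: "real (length pre) + real C * lg (n (f y)) ^ k \<le> real C' * L ^ Suc k"
    proof -
      have 2: "1 \<le> real F * L"
        using mult_mono[OF F L] by simp
      then have 1: "1 \<le> real F ^ k * L ^ k"
        using one_le_power[OF 2, of k] by (simp add: power_mult_distrib)
      have "real (length pre) + real C * lg (n (f y)) ^ k
          \<le> real (length pre) * (real F ^ k * L ^ k) + real C * (real F ^ k * L ^ k)"
        using 1 pow by (intro add_mono mult_left_mono) (auto simp: mult_le_cancel_left1)
      also have "\<dots> = (real C + real (length pre)) * (real F ^ k * L ^ k) * 1"
        by (simp add: algebra_simps)
      also have "\<dots> \<le> (real C + real (length pre)) * (real F ^ k * L ^ k) * (2 * (real F * L))"
        using 1 2 by (intro mult_left_mono) auto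
      also have "\<dots> = real C' * L ^ Suc k"
        by (simp add: C'_def algebra_simps)
      finally show ?thesis .
    qed
    have "w \<le> w'"
    proof -
      \<comment> \<open>Rounding up at most doubles a number that is at least 1.\<close>
      have "real (nat \<lceil>lg (n (f y))\<rceil>) \<le> 2 * lg (n (f y))"
        using lg_ge_1[of "n (f y)"] by linarith
      also have "\<dots> \<le> 2 * (real F * real (nat \<lceil>L\<rceil>))"
        using FL F by (smt (verit) mult_left_mono real_nat_ceiling_ge)
      finally have "nat \<lceil>lg (n (f y))\<rceil> \<le> 2 * F * nat \<lceil>L\<rceil>"
        by (metis (mono_tags) of_nat_le_iff of_nat_mult of_nat_numeral mult.assoc)
      then have "w \<le> C * (2 * F * nat \<lceil>L\<rceil>)"
        unfolding w_def by (rule mult_le_mono2)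
      also have "\<dots> = (C * 2 * F * 1) * nat \<lceil>L\<rceil>"
        by simp
      also have "\<dots> \<le> ((C + length pre) * 2 * F * F ^ k) * nat \<lceil>L\<rceil>"
        by (intro mult_le_mono) (auto simp: F_def)
      finally show ?thesis
        by (simp add: w'_def C'_def mult_ac)
    qed
    then have pow_w: "v < 2 ^ w \<Longrightarrow> v < 2 ^ w'" for v :: nat
      by (meson less_le_trans one_le_numeral power_increasing)
    have "answers w' P' D (Q' y) (real C' * L ^ Suc k)"
      unfolding answers_def
    proof (intro conjI ballI, goal_cases)
      case (1 x)
      then show ?case using ans pow_w by (auto simp: answers_def w_def)
    next
      case (2 q)
      obtain args a where q: "q = (args, a)" by fastforce
      obtain args' where args': "(args', a) \<in> Q (f y)"
        and pre: "\<And>w D. (\<forall>v\<in>set args'. v < 2 ^ w) \<Longrightarrow> (\<forall>v\<in>set args. v < 2 ^ w) \<and>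
           exec_straight w pre (init_state D args) =
             Some ((init_state D args')\<lparr>pc := length pre\<rparr>)"
        using query[OF y] 2 unfolding q by blast
      have small: "\<forall>v\<in>set args'. v < 2 ^ w'"
        and "\<exists>t. real t \<le> real C * lg (n (f y)) ^ k \<and> ram_returns w P (init_state D args') t a"
        using ans args' pow_w by (auto simp: answers_def w_def)
      then obtain t where t: "real t \<le> real C * lg (n (f y)) ^ k"
        and ret: "ram_returns w P (init_state D args') t a" by blast
      have "ram_returns w' P' ((init_state D args')\<lparr>pc := length pre\<rparr>) t a"
        using ram_returns_relocate[OF ram_returns_mono[OF ret \<open>w \<le> w'\<close>], of pre]
        by (simp add: P'_def init_state_def)
      then have "ram_returns w' P' (init_state D args) (length pre + t) a"
        using ram_returns_straight[OF straight, of w' "init_state D args" _ "[]"] pre[OF small]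
        by (simp add: P'_def init_state_def)
      moreover have "real (length pre + t) \<le> real C' * L ^ Suc k"
        using t time by simp
      ultimately show ?case
        using pre[OF small] unfolding q by blast
    qed
    then show ?thesis
      using size unfolding L_def w'_def by blast
  qed
  then show ?thesis
    unfolding has_polylog_structures_def by blast
qed

section \<open>The 2D SLP of a 1D SLP\<close>

text \<open>Nonterminals must be natural numbers, so pairs are encoded. First component 0 is
  reserved for zero columns and \<open>Suc N\<close> belongs to \<open>N\<close>, which keeps the
  two families apart; the second component is the binary logarithm of the height.\<close>

definition zero_nt :: "nat \<Rightarrow> nat" where
  "zero_nt i = prod_encode (0, i)"

definition letter_nt :: "nat \<Rightarrow> nat \<Rightarrow> nat" where
  "letter_nt N i = prod_encode (Suc N, i)"

lemma nt_simps [simp]: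
  "zero_nt i = zero_nt j \<longleftrightarrow> i = j"
  "letter_nt N i = letter_nt N' j \<longleftrightarrow> N = N' \<and> i = j"
  "zero_nt i \<noteq> letter_nt N j"
  "letter_nt N j \<noteq> zero_nt i"
  by (auto simp: zero_nt_def letter_nt_def)

fun indicator_rule :: "(nat \<Rightarrow> nat rhs) \<Rightarrow> nat \<Rightarrow> nat \<times> nat \<Rightarrow> nat rhs" where
  "indicator_rule R m (0, 0) = Lit 0"
| "indicator_rule R m (0, Suc i) = Cat (zero_nt i) (zero_nt i)"
| "indicator_rule R m (Suc N, i) =
    (case R N of
       Lit a \<Rightarrow>
         (case i of
            0 \<Rightarrow> Lit 1
          | Suc i \<Rightarrow> if bit a i then Cat (zero_nt i) (letter_nt N i)
                    else Cat (letter_nt N i) (zero_nt i))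
     | Cat A B \<Rightarrow> Cat (letter_nt A m) (letter_nt B m))"

text \<open>\<^term>\<open>zero_nt i\<close> expands to the zero column of height \<open>2 ^ i\<close>.  For a literal \<open>N\<close> with letter
  \<open>a\<close>, \<^term>\<open>letter_nt N i\<close> expands to the column of height \<open>2 ^ i\<close> with a single one, in the row
  given by the last \<open>i\<close> binary digits of \<open>a\<close>.  For the other nonterminals \<open>N\<close> of the 1D SLP, only
  \<^term>\<open>letter_nt N m\<close> is used.\<close>

definition indicator_slp :: "nat slp1 \<Rightarrow> nat \<Rightarrow> nat slp2" where
  "indicator_slp G m =
     \<lparr>literals = {zero_nt 0} \<union> {letter_nt N 0 | N a. N \<in> nonterms1 G \<and> rule1 G N = Lit a},
      horizontals = {zero_nt (Suc i) | i. i < m} \<union>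
        {letter_nt N (Suc i) | N i a. N \<in> nonterms1 G \<and> rule1 G N = Lit a \<and> i < m},
      verticals = {letter_nt N m | N A B. N \<in> nonterms1 G \<and> rule1 G N = Cat A B},
      alphabet2 = {0, 1},
      rule2 = (\<lambda>x. indicator_rule (rule1 G) m (prod_decode x)),
      start2 = letter_nt (start1 G) m\<rparr>"

definition indicator_mat :: "nat \<Rightarrow> nat list \<Rightarrow> nat mat" where
  "indicator_mat r T = mat r (length T) (\<lambda>(i, j). if T ! j = i then 1 else 0)"

section \<open>Dimensions and expansions of the nonterminals\<close>

lemma dim_indicator_mat [simp]:
  "dim_row (indicator_mat r T) = r" "dim_col (indicator_mat r T) = length T"
  by (simp_all add: indicator_mat_def)

lemma dim_append_cols [simp]:
  "dim_row (append_cols A B) = dim_row A" "dim_col (append_cols A B) = dim_col A + dim_col B"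
  by (simp_all add: append_cols_def)

lemma dim_append_rows:
  "dim_row (A @\<^sub>r B) = dim_row A + dim_row B" "dim_col (A @\<^sub>r B) = dim_col A"
  by (simp_all add: append_rows_def)

lemma indicator_rule_nt [simp]:
  "rule2 (indicator_slp G m) (zero_nt 0) = Lit 0"
  "rule2 (indicator_slp G m) (zero_nt (Suc i)) = Cat (zero_nt i) (zero_nt i)"
  "rule1 G N = Lit a \<Longrightarrow> rule2 (indicator_slp G m) (letter_nt N 0) = Lit 1"
  "rule1 G N = Lit a \<Longrightarrow> rule2 (indicator_slp G m) (letter_nt N (Suc i)) =
     (if bit a i then Cat (zero_nt i) (letter_nt N i) else Cat (letter_nt N i) (zero_nt i))"
  "rule1 G N = Cat A B \<Longrightarrow>
     rule2 (indicator_slp G m) (letter_nt N i) = Cat (letter_nt A m) (letter_nt B m)"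
  by (simp_all add: indicator_slp_def zero_nt_def letter_nt_def)

text \<open>Heights can be read off the encoding, and only vertical rules widen a matrix. This
  settles the dimension conditions of \<open>valid_slp2\<close>, which speak about arbitrary
  expansions, without computing any of them.\<close>

lemma expands2_dim:
  assumes "expands2 (indicator_slp G m) x X"
  shows "dim_row X = 2 ^ snd (prod_decode x) \<and>
    (x \<notin> verticals (indicator_slp G m) \<longrightarrow> dim_col X = 1)"
  using assms
proof induction
  case (lit N a)
  then show ?case
    by (auto simp: indicator_slp_def zero_nt_def letter_nt_def)
next
  case (hor N A B X Y)
  then show ?case
    by (auto simp: indicator_slp_def zero_nt_def letter_nt_def dim_append_rows split: if_splits)
next
  case (ver N A B X Y)
  then show ?case
    by (auto simp: indicator_slp_def zero_nt_def letter_nt_def)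
qed

lemma expands2_zero_nt:
  "i \<le> m \<Longrightarrow> expands2 (indicator_slp G m) (zero_nt i) (mat (2 ^ i) 1 (\<lambda>_. 0))"
proof (induction i)
  case 0
  have "mat (2 ^ 0) 1 (\<lambda>_. 0) = (mat 1 1 (\<lambda>_. 0) :: nat mat)"
    by simp
  moreover have "zero_nt 0 \<in> literals (indicator_slp G m)"
    by (simp add: indicator_slp_def)
  ultimately show ?case
    by (metis expands2.lit indicator_rule_nt(1))
next
  case (Suc i)
  let ?Z = "mat (2 ^ i) 1 (\<lambda>_. 0) :: nat mat"
  have "expands2 (indicator_slp G m) (zero_nt (Suc i)) (?Z @\<^sub>r ?Z)"
    by (rule expands2.hor[where A = "zero_nt i" and B = "zero_nt i"])
      (use Suc in \<open>auto simp: indicator_slp_def zero_nt_def\<close>)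
  also have "?Z @\<^sub>r ?Z = mat (2 ^ Suc i) 1 (\<lambda>_. 0)"
    by (rule eq_matI) (auto simp: append_rows_def)
  finally show ?case .
qed

text \<open>Bit \<open>i\<close> of \<open>a\<close> selects the half that contains the one: if it
  is set, the row index grows by \<open>2 ^ i\<close>, so the zero column goes on top; otherwise it
  goes below.\<close>

lemma expands2_letter_nt_Lit:
  assumes "N \<in> nonterms1 G" "rule1 G N = Lit a"
  shows "i \<le> m \<Longrightarrow> expands2 (indicator_slp G m) (letter_nt N i) (indicator_mat (2 ^ i) [take_bit i a])"
proof (induction i)
  case 0
  have "indicator_mat (2 ^ 0) [take_bit 0 a] = mat 1 1 (\<lambda>_. 1)"
    by (rule eq_matI) (auto simp: indicator_mat_def)
  moreover have "letter_nt N 0 \<in> literals (indicator_slp G m)"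
    using assms by (auto simp: indicator_slp_def)
  ultimately show ?case
    by (metis expands2.lit indicator_rule_nt(3) assms(2))
next
  case (Suc i)
  let ?Z = "mat (2 ^ i) 1 (\<lambda>_. 0) :: nat mat" and ?E = "indicator_mat (2 ^ i) [take_bit i a]"
  have hor: "letter_nt N (Suc i) \<in> horizontals (indicator_slp G m)"
    using assms Suc.prems by (auto simp: indicator_slp_def)
  have Z: "expands2 (indicator_slp G m) (zero_nt i) ?Z"
    using Suc.prems by (intro expands2_zero_nt) simp
  have E: "expands2 (indicator_slp G m) (letter_nt N i) ?E"
    using Suc by simp
  have bound: "take_bit i a < 2 ^ i" by simp
  show ?case
  proof (cases "bit a i")
    case True
    have "expands2 (indicator_slp G m) (letter_nt N (Suc i)) (?Z @\<^sub>r ?E)"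
      by (rule expands2.hor[OF hor _ Z E]) (use assms True in simp)
    also have "?Z @\<^sub>r ?E = indicator_mat (2 ^ Suc i) [take_bit (Suc i) a]"
      using True by (intro eq_matI)
        (auto simp: append_rows_def indicator_mat_def take_bit_Suc_from_most)
    finally show ?thesis .
  next
    case False
    have "expands2 (indicator_slp G m) (letter_nt N (Suc i)) (?E @\<^sub>r ?Z)"
      by (rule expands2.hor[OF hor _ E Z]) (use assms False in simp)
    also have "?E @\<^sub>r ?Z = indicator_mat (2 ^ Suc i) [take_bit (Suc i) a]"
      using False bound by (intro eq_matI)
        (auto simp: append_rows_def indicator_mat_def take_bit_Suc_from_most)
    finally show ?thesis .
  qed
qed

lemma append_cols_indicator_mat:
  "append_cols (indicator_mat r u) (indicator_mat r v) = indicator_mat r (u @ v)"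
  by (rule eq_matI) (auto simp: append_cols_def indicator_mat_def nth_append)

text \<open>The bound on the letters ensures that \<open>m\<close> binary digits determine each of
  them, and concatenation of strings becomes juxtaposition of columns.\<close>

lemma expands2_indicator_slp:
  assumes "expands1 G N u" "\<forall>N\<in>nonterms1 G. \<forall>a. rule1 G N = Lit a \<longrightarrow> a < 2 ^ m"
  shows "expands2 (indicator_slp G m) (letter_nt N m) (indicator_mat (2 ^ m) u)"
  using assms(1)
proof induction
  case (lit N a)
  with assms(2) have "take_bit m a = a" by (simp add: take_bit_nat_eq_self)
  with expands2_letter_nt_Lit[OF lit, of m m] show ?case by simp
next
  case (cat N A B u v)
  show ?case
    unfolding append_cols_indicator_mat[symmetric]
    by (rule expands2.ver[OF _ _ cat.IH]) (use cat.hyps in \<open>auto simp: indicator_slp_def letter_nt_def\<close>)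
qed

section \<open>Acyclicity and validity of the 2D SLP\<close>

text \<open>A level function with ties suffices: ordering lexicographically by level and then by the
  nonterminal itself makes it injective.\<close>

lemma acyclic_rulesI:
  assumes "finite V" "\<And>N A B. N \<in> V \<Longrightarrow> R N = Cat A B \<Longrightarrow> f N < f A \<and> f N < (f B :: nat)"
  shows "acyclic_rules V R"
proof -
  obtain M where M: "\<And>x. x \<in> V \<Longrightarrow> x < M"
    using assms(1) by (metis finite_nat_set_iff_bounded)
  \<comment> \<open>As \<open>x < M\<close> on \<open>V\<close>, this encodes the lexicographic
    order: the remainder modulo \<open>M\<close> recovers \<open>x\<close>, and a higher level
    outweighs any difference below \<open>M\<close>.\<close>
  define pos where "pos x = f x * M + x" for x
  have "inj_on pos V"
  proof (rule inj_onI)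
    fix x y assume "x \<in> V" "y \<in> V" "pos x = pos y"
    then have "pos x mod M = pos y mod M" "x < M" "y < M" using M by auto
    then show "x = y" by (simp add: pos_def)
  qed
  moreover have "pos x < pos y" if "x \<in> V" "f x < f y" for x y
  proof -
    have "pos x < Suc (f x) * M" using M[OF that(1)] by (simp add: pos_def)
    also have "\<dots> \<le> f y * M" using that(2) by (intro mult_le_mono1) simp
    also have "\<dots> \<le> pos y" by (simp add: pos_def)
    finally show ?thesis .
  qed
  ultimately show ?thesis
    using assms(2) unfolding acyclic_rules_def by (intro exI[of _ pos]) blast
qed

lemma nonterms2_indicator_slp_cases:
  assumes "x \<in> nonterms2 (indicator_slp G m)"
  obtains i where "i \<le> m" "x = zero_nt i"
  | N a i where "N \<in> nonterms1 G" "rule1 G N = Lit a" "i \<le> m" "x = letter_nt N i"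
  | N A B where "N \<in> nonterms1 G" "rule1 G N = Cat A B" "x = letter_nt N m"
  using assms unfolding nonterms2_def indicator_slp_def
  by (auto simp: less_eq_Suc_le)

lemma zero_nt_in_nonterms2:
  "i \<le> m \<Longrightarrow> zero_nt i \<in> nonterms2 (indicator_slp G m)"
  by (cases i) (auto simp: nonterms2_def indicator_slp_def)

lemma letter_nt_Lit_in_nonterms2:
  "i \<le> m \<Longrightarrow> N \<in> nonterms1 G \<Longrightarrow> rule1 G N = Lit a \<Longrightarrow>
    letter_nt N i \<in> nonterms2 (indicator_slp G m)"
  by (cases i) (auto simp: nonterms2_def indicator_slp_def)

lemma letter_nt_in_nonterms2:
  "N \<in> nonterms1 G \<Longrightarrow> letter_nt N m \<in> nonterms2 (indicator_slp G m)"
  by (cases "rule1 G N")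
    (auto intro: letter_nt_Lit_in_nonterms2, auto simp: nonterms2_def indicator_slp_def)

lemma nonterms2_indicator_slp_subset:
  "nonterms2 (indicator_slp G m) \<subseteq> prod_encode ` (insert 0 (Suc ` nonterms1 G) \<times> {..m})"
  by (auto elim!: nonterms2_indicator_slp_cases simp: zero_nt_def letter_nt_def)

lemma finite_nonterms2_indicator_slp:
  "finite (nonterms1 G) \<Longrightarrow> finite (nonterms2 (indicator_slp G m))"
  by (rule finite_subset[OF nonterms2_indicator_slp_subset]) simp

lemma acyclic_indicator_slp:
  assumes "valid_slp1 G"
  shows "acyclic_rules (nonterms2 (indicator_slp G m)) (rule2 (indicator_slp G m))"
proof -
  have fin: "finite (nonterms1 G)" using assms by (simp add: valid_slp1_def)
  obtain pos :: "nat \<Rightarrow> nat" where pos: "\<And>N A B. N \<in> nonterms1 G \<Longrightarrow> rule1 G N = Cat A B \<Longrightarrow>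
      pos N < pos A \<and> pos N < pos B"
    using assms unfolding valid_slp1_def acyclic_rules_def by blast
  obtain M where M: "\<And>N. N \<in> nonterms1 G \<Longrightarrow> pos N < M"
    using fin by (metis finite_imageI finite_nat_set_iff_bounded imageI)
  \<comment> \<open>Concatenations keep their old position, which is below \<open>M\<close>. All
    columns lie at \<open>M\<close> or above, with the shorter ones later.\<close>
  define f where "f x = (case prod_decode x of
      (0, i) \<Rightarrow> M + (m - i)
    | (Suc N, i) \<Rightarrow> (case rule1 G N of Lit a \<Rightarrow> M + (m - i) | Cat A B \<Rightarrow> pos N))" for x
  have f [simp]: "f (zero_nt i) = M + (m - i)"
    "rule1 G N = Lit a \<Longrightarrow> f (letter_nt N i) = M + (m - i)"
    "rule1 G N = Cat A B \<Longrightarrow> f (letter_nt N i) = pos N" for i N a A B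
    by (simp_all add: f_def zero_nt_def letter_nt_def)
  have f_letter: "pos N < f (letter_nt A i)" if "N \<in> nonterms1 G" "pos N < pos A" for N A i
    using M[OF that(1)] that(2) by (cases "rule1 G A") auto
  show ?thesis
  proof (rule acyclic_rulesI[where f = f])
    show "finite (nonterms2 (indicator_slp G m))"
      using fin by (rule finite_nonterms2_indicator_slp)
    fix x A B
    assume "x \<in> nonterms2 (indicator_slp G m)" "rule2 (indicator_slp G m) x = Cat A B"
    then show "f x < f A \<and> f x < f B"
    proof (cases rule: nonterms2_indicator_slp_cases)
      case (1 i)
      with \<open>rule2 _ x = _\<close> show ?thesis by (cases i) auto
    next
      case (2 N a i)
      with \<open>rule2 _ x = _\<close> show ?thesis by (cases i) (auto split: if_splits)
    next
      case (3 N A' B')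
      with \<open>rule2 _ x = _\<close> pos[OF 3(1,2)] show ?thesis by (auto intro: f_letter)
    qed
  qed
qed

lemma valid_indicator_slp:
  assumes "valid_slp1 G"
  shows "valid_slp2 (indicator_slp G m)"
proof -
  let ?H = "indicator_slp G m"
  have G: "finite (nonterms1 G)" "start1 G \<in> nonterms1 G"
    "\<And>N A B. N \<in> nonterms1 G \<Longrightarrow> rule1 G N = Cat A B \<Longrightarrow> A \<in> nonterms1 G \<and> B \<in> nonterms1 G"
    using assms by (auto simp: valid_slp1_def)
  have sel: "alphabet2 ?H = {0, 1}" "start2 ?H = letter_nt (start1 G) m"
    by (simp_all add: indicator_slp_def)
  have lit: "x \<in> literals ?H \<Longrightarrow> \<exists>a\<in>{0, 1}. rule2 ?H x = Lit a" for x
    by (auto simp: indicator_slp_def zero_nt_def letter_nt_def)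
  have cat: "\<exists>A\<in>nonterms2 ?H. \<exists>B\<in>nonterms2 ?H. rule2 ?H x = Cat A B"
    if "x \<in> horizontals ?H \<union> verticals ?H" for x
  proof -
    from that consider i where "i < m" "x = zero_nt (Suc i)"
      | N i a where "N \<in> nonterms1 G" "rule1 G N = Lit a" "i < m" "x = letter_nt N (Suc i)"
      | N A B where "N \<in> nonterms1 G" "rule1 G N = Cat A B" "x = letter_nt N m"
      by (auto simp: indicator_slp_def)
    then show ?thesis
    proof cases
      case 1
      then show ?thesis by (auto intro: zero_nt_in_nonterms2)
    next
      case 2
      then show ?thesis by (auto intro: zero_nt_in_nonterms2 letter_nt_Lit_in_nonterms2)
    next
      case 3
      then show ?thesis using G(3)[OF 3(1,2)] by (auto intro: letter_nt_in_nonterms2)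
    qed
  qed
  have hor: "dim_col X = dim_col Y"
    if "x \<in> horizontals ?H" "rule2 ?H x = Cat A B" "expands2 ?H A X" "expands2 ?H B Y" for x A B X Y
  proof -
    \<comment> \<open>Horizontal rules combine only zero columns and parts of unit columns, so both
      operands have width 1.\<close>
    have "A \<notin> verticals ?H \<and> B \<notin> verticals ?H"
      using that(1,2)
      by (auto simp: indicator_slp_def prod_encode_inverse zero_nt_def letter_nt_def split: if_splits)
    then show ?thesis using expands2_dim[OF that(3)] expands2_dim[OF that(4)] by simp
  qed
  have ver: "dim_row X = dim_row Y"
    if "x \<in> verticals ?H" "rule2 ?H x = Cat A B" "expands2 ?H A X" "expands2 ?H B Y" for x A B X Y
  proof -
    \<comment> \<open>Both operands of a vertical rule carry the second component
      \<open>m\<close>.\<close>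
    have "snd (prod_decode A) = snd (prod_decode B)"
      using that(1,2) by (auto simp: indicator_slp_def letter_nt_def)
    then show ?thesis using expands2_dim[OF that(3)] expands2_dim[OF that(4)] by simp
  qed
  have disj: "literals ?H \<inter> horizontals ?H = {}" "literals ?H \<inter> verticals ?H = {}"
    "horizontals ?H \<inter> verticals ?H = {}"
    by (auto simp: indicator_slp_def)
  show ?thesis
    unfolding valid_slp2_def sel
    using disj lit cat hor ver finite_nonterms2_indicator_slp[OF G(1)] letter_nt_in_nonterms2[OF G(2)]
      acyclic_indicator_slp[OF assms]
    by blast
qed

section \<open>Size of the 2D SLP\<close>

lemma rhs_length_le_2: "rhs_length r \<le> 2"
  by (cases r) auto

text \<open>One factor 2 bounds the right-hand sides. The other absorbs the extra family of zero
  columns, as the 1D grammar has at least one nonterminal.\<close>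

lemma size_indicator_slp:
  assumes "valid_slp1 G"
  shows "size_slp2 (indicator_slp G m) \<le> 4 * size_slp1 G * Suc m"
proof -
  let ?V = "nonterms1 G" and ?W = "nonterms2 (indicator_slp G m)"
  have fin: "finite ?V" and ne: "?V \<noteq> {}" using assms by (auto simp: valid_slp1_def)
  have "size_slp2 (indicator_slp G m) \<le> card ?W * 2"
    unfolding size_slp2_def rules_size_def
    using sum_bounded_above[of ?W "\<lambda>N. max (rhs_length (rule2 (indicator_slp G m) N)) 1" 2]
    by (simp add: rhs_length_le_2)
  moreover have "card ?W \<le> Suc (card ?V) * Suc m"
  proof -
    have "card ?W \<le> card (prod_encode ` (insert 0 (Suc ` ?V) \<times> {..m}))"
      using fin by (intro card_mono nonterms2_indicator_slp_subset) simp
    also have "\<dots> \<le> card (insert 0 (Suc ` ?V) \<times> {..m})"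
      using fin by (intro card_image_le) simp
    also have "\<dots> = Suc (card ?V) * Suc m"
      using fin by (simp add: card_cartesian_product card_image)
    finally show ?thesis .
  qed
  moreover have "Suc (card ?V) * Suc m \<le> (2 * size_slp1 G) * Suc m"
  proof (rule mult_le_mono1)
    have "0 < card ?V"
      using fin ne by (simp add: card_gt_0_iff)
    moreover have "card ?V \<le> size_slp1 G"
      unfolding size_slp1_def rules_size_def
      using sum_bounded_below[of ?V 1 "\<lambda>N. max (rhs_length (rule1 G N)) 1"] by simp
    ultimately show "Suc (card ?V) \<le> 2 * size_slp1 G" by simp
  qed
  ultimately show ?thesis by simp
qed

section \<open>Row sums of the indicator matrix as ranks\<close>

text \<open>Query positions start at 1 but letters at 0, so the row of letter \<open>c\<close> is
  the half-open range from \<open>c\<close> to \<open>Suc c\<close>.\<close>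

lemma sum_query_indicator_mat:
  assumes "c < r" "j \<le> length T"
  shows "sum_query (indicator_mat r T) c (Suc c) 0 j = rank_query T j c"
proof -
  have "{c<..Suc c} = {Suc c}" by auto
  then have "sum_query (indicator_mat r T) c (Suc c) 0 j =
      (\<Sum>i\<in>{0<..j}. indicator_mat r T $$ (c, i - 1))"
    by (simp add: sum_query_def flip: sum.cartesian_product)
  also have "\<dots> = (\<Sum>i\<in>{0<..j}. if T ! (i - 1) = c then 1 else 0)"
    using assms by (intro sum.cong) (auto simp: indicator_mat_def)
  also have "\<dots> = rank_query T j c"
    by (simp add: rank_query_def sum.If_cases Int_def)
  finally show ?thesis .
qed

section \<open>Rank queries\<close>

text \<open>Register 2 first supplies the constant 1 for the row number, then is cleared and
  receives a copy of \<open>j\<close>; copying is addition to zero. The bound on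
  \<open>Suc c\<close> also yields a word size of at least one bit, so the constant 1 fits.\<close>

lemma exec_line_sum_args:
  assumes "\<forall>v\<in>set [j, Suc c, j]. v < 2 ^ w"
  shows "exec_straight w [Const 2 1, Op Add 1 1 2, Const 2 0, Op Add 2 2 0] (init_state D [j, c]) =
    Some ((init_state D [j, Suc c, j])\<lparr>pc := 4\<rparr>)"
proof -
  have "1 < (2::nat) ^ w" "Suc c < 2 ^ w" "j < 2 ^ w" using assms by auto
  then show ?thesis
    by (auto simp: set_reg_def init_state_def fun_eq_iff nth_Cons' numeral_eq_Suc less_Suc_eq)
qed

text \<open>\<open>j\<close> is saved in register 3, initially 0, before register 0 is overwritten
  by \<open>c\<close>. Register 2 lends the constant 1 and ends as 0, the required left column
  bound.\<close>

lemma exec_sum_args: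
  assumes "\<forall>v\<in>set [c, Suc c, 0, j]. v < 2 ^ w"
  shows "exec_straight w
    [Op Add 3 3 0, Const 0 0, Op Add 0 0 1, Const 2 1, Op Add 1 1 2, Const 2 0] (init_state D [j, c]) =
    Some ((init_state D [c, Suc c, 0, j])\<lparr>pc := 6\<rparr>)"
proof -
  have "1 < (2::nat) ^ w" "Suc c < 2 ^ w" "c < 2 ^ w" "j < 2 ^ w" using assms by auto
  then show ?thesis
    by (auto simp: set_reg_def init_state_def fun_eq_iff nth_Cons' numeral_eq_Suc less_Suc_eq)
qed

lemma expands1_nonempty: "expands1 G N u \<Longrightarrow> u \<noteq> []"
  by (induction rule: expands1.induct) auto

theorem theorem1p3:
  assumes
    "has_polylog_structures
       {(G :: nat slp2, T). valid_slp2 G \<and> alphabet2 G = {0, 1} \<and> represents2 G T}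
       (\<lambda>(G, T). size_slp2 G)
       (\<lambda>(G, T). max (dim_row T) (dim_col T))
       (\<lambda>(G, T). line_sum_queries T)
     \<or>
     has_polylog_structures
       {(G :: nat slp2, T). valid_slp2 G \<and> alphabet2 G = {0, 1} \<and> represents2 G T}
       (\<lambda>(G, T). size_slp2 G)
       (\<lambda>(G, T). max (dim_row T) (dim_col T))
       (\<lambda>(G, T). sum_queries T)"
  shows
    "\<forall>K d :: nat.
       has_polylog_structures
         {(G :: nat slp1, T). valid_slp1 G \<and> represents1 G T \<and>
            (\<exists>\<sigma>. alphabet1 G = {0..<\<sigma>} \<and> \<sigma> \<le> K * length T ^ d)}
         (\<lambda>(G, T). size_slp1 G)
         (\<lambda>(G, T). length T)
         (\<lambda>(G, T). rank_queries (alphabet1 G) T)"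
proof (intro allI)
  fix K d :: nat
  let ?J = "{(G :: nat slp1, T). valid_slp1 G \<and> represents1 G T \<and>
            (\<exists>\<sigma>. alphabet1 G = {0..<\<sigma>} \<and> \<sigma> \<le> K * length T ^ d)}"
  let ?I = "{(G :: nat slp2, T). valid_slp2 G \<and> alphabet2 G = {0, 1} \<and> represents2 G T}"
  \<comment> \<open>Chosen so that \<open>K * length T ^ d \<le> 2 ^ m T\<close>, using
    \<open>K \<le> 2 ^ K\<close> and that \<open>length T\<close> is at most 2 to the rounded
    logarithm. As \<open>K\<close> and \<open>d\<close> are fixed, \<open>m T\<close> is
    logarithmic.\<close>
  define m where "m T = K + d * nat \<lceil>lg (length T)\<rceil>" for T :: "nat list"
  define f where "f = (\<lambda>(G, T). (indicator_slp G (m T), indicator_mat (2 ^ m T) T))"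
  \<comment> \<open>The 4 comes from \<open>size_indicator_slp\<close>; the other factor bounds
    \<open>Suc (m T)\<close> relative to the logarithm, with \<open>2 * d\<close> allowing for
    rounding up.\<close>
  define E where "E = 4 * (K + 2 * d + 1)"
  have len: "1 \<le> length T" if "(G, T) \<in> ?J" for G T
    using that expands1_nonempty by (auto simp: represents1_def Suc_le_eq)
  have alphabet: "c < 2 ^ m T" if GT: "(G, T) \<in> ?J" and c: "c \<in> alphabet1 G" for G T c
  proof -
    let ?b = "nat \<lceil>lg (length T)\<rceil>"
    have "log 2 (length T) \<le> real ?b"
      by (metis lg_def max.bounded_iff real_nat_ceiling_ge)
    then have "real (length T) \<le> 2 powr real ?b"
      using len[OF GT] by (subst (asm) log_le_iff) auto
    then have "real (length T) \<le> real (2 ^ ?b)"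
      by (simp add: powr_realpow)
    then have len_le: "length T \<le> 2 ^ ?b"
      by (simp only: of_nat_le_iff)
    have "c < K * length T ^ d" using GT c by auto
    also have "\<dots> \<le> 2 ^ K * (2 ^ ?b) ^ d"
      using len_le by (intro mult_le_mono power_mono) (auto simp: less_imp_le)
    also have "\<dots> = 2 ^ m T"
      by (simp add: m_def power_add mult.commute flip: power_mult)
    finally show ?thesis .
  qed
  have m_le: "real (Suc (m T)) \<le> (K + 2 * d + 1) * lg (length T)" for T
  proof -
    have 1: "1 \<le> lg (length T)" by (rule lg_ge_1)
    then have "real (nat \<lceil>lg (length T)\<rceil>) \<le> 2 * lg (length T)" by linarith
    then have "real d * real (nat \<lceil>lg (length T)\<rceil>) \<le> real d * (2 * lg (length T))"
      by (rule mult_left_mono) simp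
    moreover have "real K * 1 \<le> real K * lg (length T)"
      using 1 by (rule mult_left_mono) simp
    ultimately show ?thesis
      using 1 by (simp add: m_def algebra_simps)
  qed
  have instance_I: "f y \<in> ?I" if "y \<in> ?J" for y
  proof -
    obtain G T where y: "y = (G, T)" by fastforce
    have "a \<in> alphabet1 G" if "N \<in> nonterms1 G" "rule1 G N = Lit a" for N a
      using \<open>y \<in> ?J\<close> that unfolding y valid_slp1_def by force
    then have "\<forall>N\<in>nonterms1 G. \<forall>a. rule1 G N = Lit a \<longrightarrow> a < 2 ^ m T"
      using alphabet[OF that[unfolded y]] by blast
    with that have "expands2 (indicator_slp G (m T)) (letter_nt (start1 G) (m T))
        (indicator_mat (2 ^ m T) T)"
      unfolding y by (intro expands2_indicator_slp) (auto simp: represents1_def)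
    moreover have "valid_slp2 (indicator_slp G (m T))"
      using that unfolding y by (auto intro: valid_indicator_slp)
    ultimately show ?thesis
      by (simp add: y f_def represents2_def) (simp add: indicator_slp_def)
  qed
  have instance_size: "real ((\<lambda>(G, T). size_slp2 G) (f y)) \<le>
      real E * real ((\<lambda>(G, T). size_slp1 G) y) * lg ((\<lambda>(G, T). length T) y)" if "y \<in> ?J" for y
  proof -
    obtain G T where y: "y = (G, T)" by fastforce
    have "real (size_slp2 (indicator_slp G (m T))) \<le> real (4 * size_slp1 G * Suc (m T))"
      using that size_indicator_slp unfolding y by (intro of_nat_mono) auto
    also have "\<dots> = 4 * real (size_slp1 G) * real (Suc (m T))"
      by (simp add: algebra_simps)
    also have "\<dots> \<le> 4 * real (size_slp1 G) * ((K + 2 * d + 1) * lg (length T))"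
      using m_le by (rule mult_left_mono) simp
    finally show ?thesis
      by (simp add: y f_def E_def algebra_simps)
  qed
  have instance_lg: "lg ((\<lambda>(G, T). max (dim_row T) (dim_col T)) (f y)) \<le>
      real E * lg ((\<lambda>(G, T). length T) y)" if "y \<in> ?J" for y
  proof -
    obtain G T where y: "y = (G, T)" by fastforce
    have 1: "1 \<le> lg (length T)" by (rule lg_ge_1)
    have E: "(K + 2 * d + 1) * lg (length T) \<le> real E * lg (length T)"
      using 1 by (intro mult_right_mono) (auto simp: E_def)
    have "real (m T) \<le> real E * lg (length T)"
      using m_le[of T] E by simp
    moreover have "1 * lg (length T) \<le> real E * lg (length T)"
      using 1 by (intro mult_right_mono) (auto simp: E_def)
    ultimately have "max (real (m T)) (lg (length T)) \<le> real E * lg (length T)"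
      by simp
    \<comment> \<open>The cutoff of \<open>lg\<close> at 1 does no harm if \<open>m T = 0\<close>,
      since \<open>lg (length T)\<close> is at least 1.\<close>
    moreover have "lg (max (2 ^ m T) (length T)) \<le> max (real (m T)) (lg (length T))"
      by (cases "2 ^ m T \<le> length T") (simp_all add: lg_def max_def log_nat_power)
    ultimately have "lg (max (2 ^ m T) (length T)) \<le> real E * lg (length T)"
      by (rule order_trans[rotated])
    then show ?thesis
      by (simp add: y f_def)
  qed
  from assms show "has_polylog_structures ?J (\<lambda>(G, T). size_slp1 G) (\<lambda>(G, T). length T)
         (\<lambda>(G, T). rank_queries (alphabet1 G) T)"
  proof
    assume line: "has_polylog_structures ?I (\<lambda>(G, T). size_slp2 G)
      (\<lambda>(G, T). max (dim_row T) (dim_col T)) (\<lambda>(G, T). line_sum_queries T)"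
    show ?thesis
    proof (rule has_polylog_structures_reduction[where f = f and E = E and
          pre = "[Const 2 1, Op Add 1 1 2, Const 2 0, Op Add 2 2 0]",
          OF line _ instance_I instance_size instance_lg])
      fix y args ans
      assume "y \<in> ?J" "(args, ans) \<in> (\<lambda>(G, T). rank_queries (alphabet1 G) T) y"
      moreover obtain G T where y1: "y = (G, T)" by fastforce
      ultimately have y: "y = (G, T)" "(G, T) \<in> ?J" and "(args, ans) \<in> rank_queries (alphabet1 G) T"
        by simp_all
      then obtain j c where q: "args = [j, c]" "ans = rank_query T j c" "j \<le> length T" "c \<in> alphabet1 G"
        unfolding rank_queries_def by blast
      have c: "c < 2 ^ m T" using alphabet y(2) q(4) by blast
      \<comment> \<open>A segment of length \<open>j\<close> that ends in column \<open>j\<close> is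
        the prefix of the row, as its left bound is \<open>j - j = 0\<close>.\<close>
      have "([j, Suc c, j], ans) \<in> line_sum_queries (indicator_mat (2 ^ m T) T)"
        using c q sum_query_indicator_mat[OF c q(3)]
        by (auto simp: line_sum_queries_def line_sum_query_def)
      then show "\<exists>args'. (args', ans) \<in> (\<lambda>(G, T). line_sum_queries T) (f y) \<and>
        (\<forall>w D. (\<forall>v\<in>set args'. v < 2 ^ w) \<longrightarrow> (\<forall>v\<in>set args. v < 2 ^ w) \<and>
           exec_straight w [Const 2 1, Op Add 1 1 2, Const 2 0, Op Add 2 2 0] (init_state D args) =
             Some ((init_state D args')\<lparr>pc :=
               length [Const 2 1, Op Add 1 1 2, Const 2 0, Op Add 2 2 0]\<rparr>))"
        using exec_line_sum_args[of j c] unfolding y(1) q(1) f_def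
        by (intro exI[of _ "[j, Suc c, j]"]) (simp del: exec_straight.simps)
    qed simp_all
  next
    assume sum: "has_polylog_structures ?I (\<lambda>(G, T). size_slp2 G)
      (\<lambda>(G, T). max (dim_row T) (dim_col T)) (\<lambda>(G, T). sum_queries T)"
    let ?pre = "[Op Add 3 3 0, Const 0 0, Op Add 0 0 1, Const 2 1, Op Add 1 1 2, Const 2 0]"
    show ?thesis
    proof (rule has_polylog_structures_reduction[where f = f and E = E and pre = ?pre,
          OF sum _ instance_I instance_size instance_lg])
      fix y args ans
      assume "y \<in> ?J" "(args, ans) \<in> (\<lambda>(G, T). rank_queries (alphabet1 G) T) y"
      moreover obtain G T where y1: "y = (G, T)" by fastforce
      ultimately have y: "y = (G, T)" "(G, T) \<in> ?J" and "(args, ans) \<in> rank_queries (alphabet1 G) T"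
        by simp_all
      then obtain j c where q: "args = [j, c]" "ans = rank_query T j c" "j \<le> length T" "c \<in> alphabet1 G"
        unfolding rank_queries_def by blast
      have c: "c < 2 ^ m T" using alphabet y(2) q(4) by blast
      have "([c, Suc c, 0, j], ans) \<in> sum_queries (indicator_mat (2 ^ m T) T)"
        using c q sum_query_indicator_mat[OF c q(3)]
        by (auto simp: sum_queries_def)
      then show "\<exists>args'. (args', ans) \<in> (\<lambda>(G, T). sum_queries T) (f y) \<and>
        (\<forall>w D. (\<forall>v\<in>set args'. v < 2 ^ w) \<longrightarrow> (\<forall>v\<in>set args. v < 2 ^ w) \<and>
           exec_straight w ?pre (init_state D args) =
             Some ((init_state D args')\<lparr>pc := length ?pre\<rparr>))"
        using exec_sum_args[of c j] unfolding y(1) q(1) f_def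
        by (intro exI[of _ "[c, Suc c, 0, j]"]) (simp del: exec_straight.simps)
    qed simp_all
  qed
qed

end
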